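(* Given $n\in\mathbb{N}\setminus\{1\}$ and $m\in\{1,\ldots,n-1\}$, it follows that any harmonic trinomial $f(\zeta)=a\zeta^n+b\overline{\zeta}^m+c$ possesses at most $3n-2$ roots. Moreover, there exists a family of harmonic trinomials $(g_r)_{r>0}$ with exactly $3n-2$ roots. In addition, for $m=1$, the number of roots is at most $n+2$.
   Context: A harmonic trinomial is a function $f:\mathbb{C}\to\mathbb{C}$ of the form $f(\zeta)=a\zeta^n+b\overline{\zeta}^m+c$, where $a,b,c$ are non-zero complex numbers, $n,m$ are positive integers with $n>m$, and $\overline{\zeta}$ denotes the complex conjugate of $\zeta$. A root of $f$ is a point $\zeta\in\mathbb{C}$ with $f(\zeta)=0$, and the number of roots is the cardinality of the set of such points. *)

theory Defs
  imports Complex_Main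
begin

definition harmonic_trinomial :: "nat \<Rightarrow> nat \<Rightarrow> (complex \<Rightarrow> complex) \<Rightarrow> bool" where
  "harmonic_trinomial n m f \<longleftrightarrow> 0 < m \<and> m < n \<and>
     (\<exists>a b c. a \<noteq> 0 \<and> b \<noteq> 0 \<and> c \<noteq> 0 \<and> f = (\<lambda>z. a * z ^ n + b * cnj z ^ m + c))"

definition root_set :: "(complex \<Rightarrow> complex) \<Rightarrow> complex set" where
  "root_set f = {z. f z = 0}"

end

(* Divide by the constant term: z is a root iff u + v = 1 with u = A z^n and v = B conj(z)^m, i.e. iff
   u and v close up a triangle with sides P = |A| r^n, Q = |B| r^m, 1, where r = |z|. Up to conjugation
   this triangle depends only on r; if alpha, beta are its angles at the ends of the side of length 1,
   then Arg u = alpha and Arg v = -beta, or both with the opposite sign. For coprime n, m the pair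
   (u, v) comes from some z (then unique) iff h = m Arg u + n Arg v has the value prescribed by A and B
   modulo 2 pi. Here h = H(r) or -H(r) with H = m alpha - n beta, and H' has the sign of mQ - nP, so H
   increases up to the radius with nP = mQ and decreases after it. Since H starts at 0, stays below m pi
   on the increasing branch and between m pi and -n pi on the decreasing one, the two branches
   contribute at most m and n + m roots. A trinomial with gcd(n, m) = d is a coprime one in z^d.
   The bound n + 2m is attained if Q - P exceeds 1 at the turning radius, for then H runs through
   [0, m pi] and back through all of [-n pi, m pi]; take m = n - 1. *)

theory Submission
  imports Defs
begin

section \<open>Triangles with one side of length 1\<close>

text \<open>By the cosine rule, the angle between the sides of lengths 1 and \<open>x\<close> in a
  triangle whose third side is \<open>y\<close>.\<close>

definition triangle_angle :: "real \<Rightarrow> real \<Rightarrow> real" where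
  "triangle_angle x y = arccos ((1 + x\<^sup>2 - y\<^sup>2) / (2 * x))"

lemma cos_law_bounds:
  fixes x y :: real
  assumes "0 < x" "0 < y" "1 \<le> x + y" "y \<le> 1 + x" "x \<le> 1 + y"
  shows "- 1 \<le> (1 + x\<^sup>2 - y\<^sup>2) / (2 * x)" "(1 + x\<^sup>2 - y\<^sup>2) / (2 * x) \<le> 1"
proof -
  have "0 \<le> (1 + x - y) * (1 + x + y)" "0 \<le> (x + y - 1) * (1 + y - x)"
    using assms by (intro mult_nonneg_nonneg; linarith)+
  then have "- (2 * x) \<le> 1 + x\<^sup>2 - y\<^sup>2" "1 + x\<^sup>2 - y\<^sup>2 \<le> 2 * x"
    by (simp_all add: algebra_simps power2_eq_square)
  then show "- 1 \<le> (1 + x\<^sup>2 - y\<^sup>2) / (2 * x)" "(1 + x\<^sup>2 - y\<^sup>2) / (2 * x) \<le> 1"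
    using assms(1) by (simp_all add: field_simps)
qed

text \<open>Heron's formula: the numerator is 16 times the squared area. It is symmetric in
  \<open>x\<close> and \<open>y\<close>, so the derivatives of both angles will share one square
  root.\<close>

lemma one_minus_cos_law:
  fixes x y :: real
  assumes "0 < x"
  shows "1 - ((1 + x\<^sup>2 - y\<^sup>2) / (2 * x))\<^sup>2 = (((x + y)\<^sup>2 - 1) * (1 - (x - y)\<^sup>2)) / (2 * x)\<^sup>2"
  using assms by (simp add: field_simps) algebra

lemma triangle_angle_bounds:
  assumes "0 < x" "0 < y" "1 \<le> x + y" "y \<le> 1 + x" "x \<le> 1 + y"
  shows "0 \<le> triangle_angle x y" "triangle_angle x y \<le> pi"
  using cos_law_bounds[OF assms] unfolding triangle_angle_def
  by (auto intro!: arccos_lbound arccos_ubound)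

lemma cos_triangle_angle:
  assumes "0 < x" "0 < y" "1 \<le> x + y" "y \<le> 1 + x" "x \<le> 1 + y"
  shows "x * cos (triangle_angle x y) = (1 + x\<^sup>2 - y\<^sup>2) / 2"
  using cos_law_bounds[OF assms] assms(1) unfolding triangle_angle_def
  by (subst cos_arccos) auto

text \<open>The cosine rule makes the real parts add up to 1. The imaginary parts cancel since
  \<open>x * sin ?a\<close> and \<open>y * sin ?b\<close> are nonnegative with equal squares: both
  are the height over the side of length 1.\<close>

lemma triangle_closes:
  assumes "0 < x" "0 < y" "1 \<le> x + y" "y \<le> 1 + x" "x \<le> 1 + y"
  shows "of_real x * cis (triangle_angle x y) + of_real y * cis (- triangle_angle y x) = 1"
proof -
  let ?a = "triangle_angle x y" and ?b = "triangle_angle y x"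
  have a: "x * cos ?a = (1 + x\<^sup>2 - y\<^sup>2) / 2" and b: "y * cos ?b = (1 + y\<^sup>2 - x\<^sup>2) / 2"
    using assms by (intro cos_triangle_angle; linarith)+
  have "0 \<le> sin ?a" "0 \<le> sin ?b"
    using assms triangle_angle_bounds[of x y] triangle_angle_bounds[of y x]
    by (auto intro!: sin_ge_zero)
  then have nonneg: "0 \<le> x * sin ?a" "0 \<le> y * sin ?b"
    using assms by auto
  have "(x * sin ?a)\<^sup>2 = x\<^sup>2 - (x * cos ?a)\<^sup>2" "(y * sin ?b)\<^sup>2 = y\<^sup>2 - (y * cos ?b)\<^sup>2"
    by (simp_all add: power_mult_distrib sin_squared_eq algebra_simps)
  then have "(x * sin ?a)\<^sup>2 = (y * sin ?b)\<^sup>2"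
    unfolding a b by (simp add: power2_eq_square field_simps)
  then have "x * sin ?a = y * sin ?b"
    using nonneg by (simp add: power2_eq_iff_nonneg)
  then show ?thesis
    using a b by (simp add: complex_eq_iff field_simps)
qed

lemma triangle_angle_eq_0:
  assumes "0 < x" "\<bar>1 - x\<bar> = y"
  shows "triangle_angle x y = 0"
proof -
  have "y\<^sup>2 = (1 - x)\<^sup>2" using assms(2) by auto
  then have "(1 + x\<^sup>2 - y\<^sup>2) / (2 * x) = 1"
    using assms(1) by (simp add: power2_eq_square field_simps)
  then show ?thesis by (simp add: triangle_angle_def)
qed

lemma triangle_angle_eq_pi:
  assumes "0 < x"
  shows "triangle_angle x (1 + x) = pi"
proof -
  have "(1 + x\<^sup>2 - (1 + x)\<^sup>2) / (2 * x) = - 1"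
    using assms by (simp add: power2_eq_square field_simps)
  then show ?thesis by (simp add: triangle_angle_def)
qed

section \<open>Principal arguments of two numbers with sum 1\<close>

text \<open>Cosine rule in the triangle with vertices 0, 1, \<open>u\<close>. The moduli do not
  distinguish it from its mirror image, hence the absolute value.\<close>

lemma abs_Arg_eq_triangle_angle:
  assumes "u + v = 1" "u \<noteq> 0"
  shows "\<bar>Arg u\<bar> = triangle_angle (cmod u) (cmod v)"
proof -
  have v: "v = 1 - u"
    using assms(1) by (simp add: algebra_simps)
  have "(cmod v)\<^sup>2 = 1 - 2 * Re u + (cmod u)\<^sup>2"
    unfolding v cmod_power2 by (simp add: power2_eq_square algebra_simps)
  moreover have "Re u = cmod u * cos (Arg u)"
    using rcis_cmod_Arg[of u] by (metis Re_rcis)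
  ultimately have "(1 + (cmod u)\<^sup>2 - (cmod v)\<^sup>2) / (2 * cmod u) = cos \<bar>Arg u\<bar>"
    using assms(2) by (simp add: field_simps)
  moreover have "\<bar>Arg u\<bar> \<le> pi"
    using Arg_bounded[of u] by linarith
  ultimately show ?thesis
    unfolding triangle_angle_def using arccos_cos[of "\<bar>Arg u\<bar>"] by simp
qed

lemma Arg_rcis:
  assumes "0 < r" "- pi < t" "t \<le> pi"
  shows "Arg (of_real r * cis t) = t"
  using assms by (intro cis_Arg_unique) (auto simp: sgn_div_norm norm_mult scaleR_conv_of_real)

lemma Arg_positiveD:
  assumes "0 < Arg z"
  shows "0 \<le> Im z" "Im z = 0 \<Longrightarrow> Re z < 0"
proof -
  have z: "z \<noteq> 0" using assms by (auto simp: Arg_zero)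
  have "0 \<le> sin (Arg z)"
    using assms Arg_bounded[of z] by (intro sin_ge_zero) auto
  then show "0 \<le> Im z" using z by (simp add: sin_Arg zero_le_divide_iff)
  assume "Im z = 0"
  then have "sin (Arg z) = 0" using z by (simp add: sin_Arg)
  then have "\<not> Arg z < pi" using sin_gt_zero[of "Arg z"] assms by auto
  then have "Arg z = pi" using Arg_bounded[of z] by linarith
  then have "Re z / cmod z = - 1" using z cos_Arg[of z] by simp
  then show "Re z < 0" using z by (simp add: field_simps)
qed

lemma Arg_nonpositiveD:
  assumes "Arg z \<le> 0" "z \<noteq> 0"
  shows "Im z \<le> 0" "Arg z < 0 \<Longrightarrow> Im z < 0"
proof -
  have "0 \<le> sin (- Arg z)"
    using assms Arg_bounded[of z] by (intro sin_ge_zero) linarith+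
  then have "Im z / cmod z \<le> 0" using assms sin_Arg[of z] by simp
  then show "Im z \<le> 0" using assms by (simp add: divide_le_0_iff)
  assume "Arg z < 0"
  then have "0 < sin (- Arg z)"
    using Arg_bounded[of z] by (intro sin_gt_zero) linarith+
  then have "Im z / cmod z < 0" using assms sin_Arg[of z] by simp
  then show "Im z < 0" using assms by (simp add: divide_less_0_iff)
qed

text \<open>Two positive arguments would put both numbers on the negative real axis, against the sum
  1. In the second case the imaginary parts could not cancel.\<close>

lemma Arg_summands_of_one:
  assumes "u + v = 1" "u \<noteq> 0" "v \<noteq> 0"
  shows "0 < Arg u \<Longrightarrow> Arg v \<le> 0" "Arg u \<le> 0 \<Longrightarrow> 0 \<le> Arg v"
proof -
  have Im: "Im u + Im v = 0" and Re: "Re u + Re v = 1"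
    using assms(1) by (auto simp: complex_eq_iff)
  show "Arg v \<le> 0" if "0 < Arg u"
  proof (rule ccontr)
    assume "\<not> Arg v \<le> 0"
    then have v: "0 < Arg v" by simp
    have "Im u = 0" "Im v = 0"
      using Arg_positiveD(1)[OF that] Arg_positiveD(1)[OF v] Im by linarith+
    then show False
      using Arg_positiveD(2)[OF that] Arg_positiveD(2)[OF v] Re by linarith
  qed
  show "0 \<le> Arg v" if "Arg u \<le> 0"
  proof (rule ccontr)
    assume "\<not> 0 \<le> Arg v"
    then show False
      using Arg_nonpositiveD[of v] Arg_nonpositiveD(1)[of u] that assms Im by linarith
  qed
qed

section \<open>Angles of a prescribed direction in an interval\<close>

definition phases :: "complex \<Rightarrow> real \<Rightarrow> real \<Rightarrow> real set" where
  "phases c a b = {h. cis h = c \<and> a < h \<and> h \<le> b}"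

text \<open>Half-open intervals are used because \<^term>\<open>Arg\<close> takes values in \<open>(- pi, pi]\<close>, so that degenerate
  triangles are counted once.\<close>

lemma phases_card:
  assumes "a \<le> b"
  shows "finite (phases (cis d) a b)"
    and "int (card (phases (cis d) a b)) = \<lfloor>(b - d) / (2 * pi)\<rfloor> - \<lfloor>(a - d) / (2 * pi)\<rfloor>"
proof -
  let ?K = "{\<lfloor>(a - d) / (2 * pi)\<rfloor> + 1..\<lfloor>(b - d) / (2 * pi)\<rfloor>}"
  have cis: "cis h = cis d \<longleftrightarrow> (\<exists>k::int. h = d + 2 * pi * of_int k)" for h
  proof -
    have "cis h = cis d \<longleftrightarrow> cis (h - d) = 1"
      by (metis cis_divide cis_neq_zero divide_eq_1_iff)
    also have "\<dots> \<longleftrightarrow> cos (h - d) = 1"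
      by (auto simp: complex_eq_iff dest: cos_one_sin_zero)
    also have "\<dots> \<longleftrightarrow> (\<exists>k::int. h - d = of_int k * 2 * pi)"
      by (simp add: cos_one_2pi_int)
    finally show ?thesis by (auto simp: algebra_simps)
  qed
  have mem: "a < d + 2 * pi * of_int k \<and> d + 2 * pi * of_int k \<le> b \<longleftrightarrow> k \<in> ?K" for k
  proof -
    have "a < d + 2 * pi * of_int k \<longleftrightarrow> (a - d) / (2 * pi) < of_int k"
      by (auto simp: field_simps)
    moreover have "d + 2 * pi * of_int k \<le> b \<longleftrightarrow> of_int k \<le> (b - d) / (2 * pi)"
      by (auto simp: field_simps)
    ultimately show ?thesis
      by (auto simp: le_floor_iff floor_less_iff add1_zle_eq)
  qed
  have eq: "phases (cis d) a b = (\<lambda>k. d + 2 * pi * of_int k) ` ?K"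
    unfolding phases_def cis using mem by blast
  then show "finite (phases (cis d) a b)" by simp
  have "inj_on (\<lambda>k. d + 2 * pi * real_of_int k) ?K"
    by (auto simp: inj_on_def)
  then have "card (phases (cis d) a b) = card ?K"
    unfolding eq by (rule card_image)
  moreover have "\<lfloor>(a - d) / (2 * pi)\<rfloor> \<le> \<lfloor>(b - d) / (2 * pi)\<rfloor>"
    using assms by (intro floor_mono divide_right_mono) auto
  ultimately show "int (card (phases (cis d) a b)) = \<lfloor>(b - d) / (2 * pi)\<rfloor> - \<lfloor>(a - d) / (2 * pi)\<rfloor>"
    by simp
qed

lemma floor_phase_shift:
  fixes d :: real
  shows "\<lfloor>(real n * pi - d) / (2 * pi)\<rfloor> = \<lfloor>(- real n * pi - d) / (2 * pi)\<rfloor> + int n"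
proof -
  have "(real n * pi - d) / (2 * pi) = (- real n * pi - d) / (2 * pi) + of_int (int n)"
    by (simp add: field_simps)
  then show ?thesis by (metis floor_add_int)
qed

lemma phases_card_symmetric:
  "card (phases (cis d) (- real m * pi) (real m * pi)) = m"
  using phases_card(2)[of "- real m * pi" "real m * pi" d] floor_phase_shift[of m d] by simp

text \<open>The single cardinalities may depend on \<open>d\<close>. In the sum, the floors at plus
  and minus \<open>m * pi\<close> pair up, and so do those at plus and minus
  \<open>n * pi\<close>.\<close>

lemma phases_card_swapped:
  "card (phases (cis d) (- real n * pi) (real m * pi)) +
   card (phases (cis d) (- real m * pi) (real n * pi)) = n + m"
proof -
  have neg: "- real k * pi \<le> real l * pi" for k l :: nat
    by (rule mult_right_mono) auto
  show ?thesis
    using phases_card(2)[OF neg[of n m], of d] phases_card(2)[OF neg[of m n], of d]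
      floor_phase_shift[of m d] floor_phase_shift[of n d]
    by linarith
qed


section \<open>Side lengths as functions of the radius and the monotonicity of H\<close>

locale harmonic_pair =
  fixes A B :: complex and n m :: nat
  assumes A: "A \<noteq> 0" and B: "B \<noteq> 0" and m: "0 < m" and mn: "m < n"
begin

definition P :: "real \<Rightarrow> real" where "P r = cmod A * r ^ n"

definition Q :: "real \<Rightarrow> real" where "Q r = cmod B * r ^ m"

definition H :: "real \<Rightarrow> real" where
  "H r = real m * triangle_angle (P r) (Q r) - real n * triangle_angle (Q r) (P r)"

definition tri :: "real \<Rightarrow> bool" where
  "tri r \<longleftrightarrow> 0 < r \<and> 1 \<le> P r + Q r \<and> Q r \<le> 1 + P r \<and> P r \<le> 1 + Q r"

lemma PQ_pos: "0 < r \<Longrightarrow> 0 < P r" "0 < r \<Longrightarrow> 0 < Q r"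
  using A B by (auto simp: P_def Q_def)

lemma P_deriv: "0 < r \<Longrightarrow> (P has_real_derivative real n * P r / r) (at r)"
  unfolding P_def [abs_def] using mn
  by (intro DERIV_cong[OF DERIV_cmult[OF DERIV_pow]], cases n) auto

lemma Q_deriv: "0 < r \<Longrightarrow> (Q has_real_derivative real m * Q r / r) (at r)"
  unfolding Q_def [abs_def] using m
  by (intro DERIV_cong[OF DERIV_cmult[OF DERIV_pow]], cases m) auto

lemma continuous_PQ [continuous_intros]: "continuous_on S P" "continuous_on S Q"
  unfolding P_def [abs_def] Q_def [abs_def] by (auto intro!: continuous_intros)

lemma PQ_zero [simp]: "P 0 = 0" "Q 0 = 0"
  using m mn by (simp_all add: P_def Q_def)

lemma PQ_strict_mono:
  assumes "0 < r" "r < s"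
  shows "P r < P s" "Q r < Q s"
  using assms A B m mn by (auto simp: P_def Q_def intro!: power_strict_mono)

text \<open>\<open>P / Q\<close> is a constant times \<open>r ^ (n - m)\<close>; the inequality is
  cross-multiplied.\<close>

lemma P_Q_ratio_strict_mono:
  assumes "0 < r" "r < s"
  shows "P r * Q s < P s * Q r"
proof -
  have "r ^ (n - m) < s ^ (n - m)"
    using assms mn by (intro power_strict_mono) auto
  then have "(r ^ m * s ^ m * (cmod A * cmod B)) * r ^ (n - m) < (r ^ m * s ^ m * (cmod A * cmod B)) * s ^ (n - m)"
    using assms A B by (intro mult_strict_left_mono) auto
  moreover have "r ^ n = r ^ m * r ^ (n - m)" "s ^ n = s ^ m * s ^ (n - m)"
    using mn by (simp_all flip: power_add)
  ultimately show ?thesis by (simp add: P_def Q_def algebra_simps)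
qed

text \<open>Since \<open>P / Q\<close> increases, \<open>n * P \<le> m * Q\<close> passes to all
  smaller positive radii and becomes strict there: the radii before the turning point form an
  interval.\<close>

lemma inner_less:
  assumes "0 < r" "r < s" "n * P s \<le> m * Q s"
  shows "n * P r < m * Q r"
proof -
  have "Q s * (n * P r) = n * (P r * Q s)" by simp
  also have "\<dots> < n * (P s * Q r)"
    using P_Q_ratio_strict_mono[OF assms(1,2)] m mn by simp
  also have "\<dots> = (n * P s) * Q r" by simp
  also have "\<dots> \<le> (m * Q s) * Q r"
    using assms PQ_pos(2)[of r] by (intro mult_right_mono) auto
  also have "\<dots> = Q s * (m * Q r)" by simp
  finally show ?thesis
    using PQ_pos(2)[of s] assms by simp
qed

lemma outer_less:
  assumes "0 < r" "r < s" "m * Q r \<le> n * P r"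
  shows "m * Q s < n * P s"
proof (rule ccontr)
  assume "\<not> ?thesis"
  then have "n * P r < m * Q r"
    using assms by (intro inner_less[of r s]) auto
  then show False using assms by simp
qed

lemma inner_P_less_Q:
  assumes "0 < r" "n * P r \<le> m * Q r"
  shows "P r < Q r"
proof -
  have "m * P r < n * P r"
    using PQ_pos(1)[OF assms(1)] mn by simp
  then have "m * P r < m * Q r" using assms by linarith
  then show ?thesis using m by simp
qed

text \<open>As \<open>r * P' = n * P\<close> and \<open>r * Q' = m * Q\<close>, differentiating the
  cosine rule puts both angle derivatives over \<open>x * S\<close>, where \<open>S\<close> is four
  times the area. The strict inequalities make the area positive and keep \<open>arccos\<close>
  differentiable.\<close>

lemma H_deriv:
  assumes x: "0 < x" and strict: "1 < P x + Q x" "Q x < 1 + P x" "P x < 1 + Q x"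
  shows "\<exists>D > 0. (H has_real_derivative ((m * Q x)\<^sup>2 - (n * P x)\<^sup>2) * D) (at x)"
proof -
  define T where "T = (((P x + Q x)\<^sup>2 - 1) * (1 - (P x - Q x)\<^sup>2))"
  have pq: "0 < P x" "0 < Q x" using PQ_pos x by auto
  have "1 < (P x + Q x)\<^sup>2" "(P x - Q x)\<^sup>2 < 1"
    using strict pq by (auto simp: one_less_power abs_square_less_1)
  then have T: "0 < T" by (simp add: T_def)
  define S where "S = sqrt T"
  have S: "0 < S" using T by (simp add: S_def)
  \<comment> \<open>Stated for two sides with logarithmic derivatives \<open>i / x\<close> and
    \<open>j / x\<close>, so that it serves for both angles with \<open>P\<close> and
    \<open>Q\<close> exchanged.\<close>
  have angle: "((\<lambda>t. triangle_angle (f t) (g t)) has_real_derivative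
      (i * (1 + F\<^sup>2 - G\<^sup>2) - 2 * (i * F\<^sup>2 - j * G\<^sup>2)) / (x * S)) (at x)"
    if f: "(f has_real_derivative i * F / x) (at x)" and g: "(g has_real_derivative j * G / x) (at x)"
      and F: "F = f x" and G: "G = g x" and pos: "0 < F"
      and ST: "S = sqrt (((F + G)\<^sup>2 - 1) * (1 - (F - G)\<^sup>2))" for f g :: "real \<Rightarrow> real" and i j F G
  proof -
    let ?w = "(1 + F\<^sup>2 - G\<^sup>2) / (2 * F)"
    have w: "1 - ?w\<^sup>2 = (((F + G)\<^sup>2 - 1) * (1 - (F - G)\<^sup>2)) / (2 * F)\<^sup>2"
      using pos by (rule one_minus_cos_law)
    then have sq: "sqrt (1 - ?w\<^sup>2) = S / (2 * F)"
      unfolding w ST real_sqrt_divide real_sqrt_abs using pos by simp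
    then have "0 < 1 - ?w\<^sup>2" using sq S pos
      by (metis divide_pos_pos mult_pos_pos real_sqrt_gt_0_iff zero_less_numeral)
    then have "\<bar>?w\<bar> < 1" by (simp add: abs_square_less_1)
    then have wb: "- 1 < ?w" "?w < 1" unfolding abs_less_iff by linarith+
    have "((\<lambda>t. (1 + (f t)\<^sup>2 - (g t)\<^sup>2) / (2 * f t)) has_real_derivative
       ((2 * F * (i * F / x) - 2 * G * (j * G / x)) * (2 * F) - (1 + F\<^sup>2 - G\<^sup>2) * (2 * (i * F / x))) / (2 * F * (2 * F))) (at x)"
      using pos by (auto intro!: derivative_eq_intros f g simp: F G mult_ac)
    from DERIV_chain2[OF DERIV_arccos this] wb
    have "((\<lambda>t. triangle_angle (f t) (g t)) has_real_derivative
       inverse (- sqrt (1 - ?w\<^sup>2)) * (((2 * F * (i * F / x) - 2 * G * (j * G / x)) * (2 * F) - (1 + F\<^sup>2 - G\<^sup>2) * (2 * (i * F / x))) / (2 * F * (2 * F)))) (at x)"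
      unfolding triangle_angle_def F G by simp
    moreover have "inverse (- (S / (2 * F))) * (((2 * F * (i * F / x) - 2 * G * (j * G / x)) * (2 * F) - W * (2 * (i * F / x))) / (2 * F * (2 * F)))
       = (i * W - 2 * (i * F\<^sup>2 - j * G\<^sup>2)) / (x * S)" for W
      using x pos S by (simp add: divide_simps) algebra
    ultimately show ?thesis
      unfolding sq by (simp only:)
  qed
  have ST: "S = sqrt (((P x + Q x)\<^sup>2 - 1) * (1 - (P x - Q x)\<^sup>2))"
           "S = sqrt (((Q x + P x)\<^sup>2 - 1) * (1 - (Q x - P x)\<^sup>2))"
    by (simp_all add: S_def T_def add.commute power2_commute)
  note a = angle[OF P_deriv[OF x] Q_deriv[OF x] refl refl pq(1) ST(1)]
   and b = angle[OF Q_deriv[OF x] P_deriv[OF x] refl refl pq(2) ST(2)]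
  \<comment> \<open>All terms with the factor \<open>m * n\<close> cancel, which leaves the
    difference of squares.\<close>
  have combine: "m * ((n * (1 + p\<^sup>2 - q\<^sup>2) - 2 * (n * p\<^sup>2 - m * q\<^sup>2)) / (x * S)) -
        n * ((m * (1 + q\<^sup>2 - p\<^sup>2) - 2 * (m * q\<^sup>2 - n * p\<^sup>2)) / (x * S))
      = ((m * q)\<^sup>2 - (n * p)\<^sup>2) * (2 / (x * S))" for p q :: real
    using x S by (simp add: divide_simps) algebra
  have "(H has_real_derivative ((m * Q x)\<^sup>2 - (n * P x)\<^sup>2) * (2 / (x * S))) (at x)"
    unfolding H_def [abs_def]
    by (rule DERIV_cong[OF DERIV_diff[OF DERIV_cmult[OF a] DERIV_cmult[OF b]] combine])
  moreover have "0 < 2 / (x * S)" using x S by simp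
  ultimately show ?thesis by blast
qed

text \<open>At degenerate triangles \<open>arccos\<close> has no derivative, so end points of a
  range of radii are handled by continuity.\<close>

lemma continuous_H:
  assumes "\<And>r. r \<in> S \<Longrightarrow> tri r"
  shows "continuous_on S H"
  unfolding H_def [abs_def] triangle_angle_def
proof (intro continuous_intros ballI conjI)
  fix r assume "r \<in> S"
  then have r: "tri r" using assms by simp
  then have "0 < P r" "0 < Q r" "1 \<le> P r + Q r" "Q r \<le> 1 + P r" "P r \<le> 1 + Q r"
    using PQ_pos by (auto simp: tri_def)
  then show "- 1 \<le> (1 + (P r)\<^sup>2 - (Q r)\<^sup>2) / (2 * P r)" "(1 + (P r)\<^sup>2 - (Q r)\<^sup>2) / (2 * P r) \<le> 1"
    "- 1 \<le> (1 + (Q r)\<^sup>2 - (P r)\<^sup>2) / (2 * Q r)" "(1 + (Q r)\<^sup>2 - (P r)\<^sup>2) / (2 * Q r) \<le> 1"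
    "2 * P r \<noteq> 0" "2 * Q r \<noteq> 0"
    using cos_law_bounds[of "P r" "Q r"] cos_law_bounds[of "Q r" "P r"] by simp_all
qed

lemma gap_strict_mono_inner:
  assumes "0 < r" "r < s" "n * P s \<le> m * Q s"
  shows "Q r - P r < Q s - P s"
proof (rule DERIV_pos_imp_increasing_open[where f = "\<lambda>r. Q r - P r", OF assms(2)])
  show "continuous_on {r..s} (\<lambda>r. Q r - P r)"
    by (intro continuous_on_diff continuous_PQ)
  fix x assume x: "r < x" "x < s"
  then have "n * P x < m * Q x" using assms by (intro inner_less[of x s]) auto
  then have "0 < m * Q x / x - n * P x / x"
    using x assms by (simp add: field_simps)
  moreover have "((\<lambda>r. Q r - P r) has_real_derivative m * Q x / x - n * P x / x) (at x)"
    using x assms by (intro DERIV_diff P_deriv Q_deriv) auto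
  ultimately show "\<exists>y. ((\<lambda>r. Q r - P r) has_real_derivative y) (at x) \<and> 0 < y"
    by blast
qed

lemma gap_strict_mono_outer:
  assumes "0 < r" "r < s" "m * Q r \<le> n * P r"
  shows "P r - Q r < P s - Q s"
proof (rule DERIV_pos_imp_increasing_open[where f = "\<lambda>r. P r - Q r", OF assms(2)])
  show "continuous_on {r..s} (\<lambda>r. P r - Q r)"
    by (intro continuous_on_diff continuous_PQ)
  fix x assume x: "r < x" "x < s"
  then have "m * Q x < n * P x" using assms by (intro outer_less[of r x]) auto
  then have "0 < n * P x / x - m * Q x / x"
    using x assms by (simp add: field_simps)
  moreover have "((\<lambda>r. P r - Q r) has_real_derivative n * P x / x - m * Q x / x) (at x)"
    using x assms by (intro DERIV_diff P_deriv Q_deriv) auto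
  ultimately show "\<exists>y. ((\<lambda>r. P r - Q r) has_real_derivative y) (at x) \<and> 0 < y"
    by blast
qed

text \<open>\<open>P + Q\<close> and \<open>Q - P\<close> both increase here, so the first
  inequality comes from \<open>r\<close> and the second from \<open>s\<close>; the third holds since
  \<open>P < Q\<close>.\<close>

lemma tri_between_inner:
  assumes "tri r" "tri s" "n * P s \<le> m * Q s" "r < x" "x < s"
  shows "1 < P x + Q x" "Q x < 1 + P x" "P x < 1 + Q x"
proof -
  have pos: "0 < r" "0 < x" using assms by (auto simp: tri_def)
  have "n * P x < m * Q x" using pos assms by (intro inner_less[of x s]) auto
  then have "P x < Q x" using pos by (intro inner_P_less_Q) auto
  moreover have "P r < P x" "Q r < Q x" "Q x - P x < Q s - P s"
    using pos assms by (auto intro: PQ_strict_mono gap_strict_mono_inner)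
  moreover have "1 \<le> P r + Q r" "Q s \<le> 1 + P s" using assms by (auto simp: tri_def)
  ultimately show "1 < P x + Q x" "Q x < 1 + P x" "P x < 1 + Q x" by linarith+
qed

text \<open>Beyond the turning radius \<open>P - Q\<close> increases, so it stays strictly between
  its bounds -1 at \<open>r\<close> and 1 at \<open>s\<close>.\<close>

lemma tri_between_outer:
  assumes "tri r" "tri s" "m * Q r \<le> n * P r" "r < x" "x < s"
  shows "1 < P x + Q x" "Q x < 1 + P x" "P x < 1 + Q x"
proof -
  have pos: "0 < r" "0 < x" using assms by (auto simp: tri_def)
  have "m * Q x < n * P x" using pos assms by (intro outer_less[of r x]) auto
  then have "P x - Q x < P s - Q s" using pos assms by (intro gap_strict_mono_outer) auto
  moreover have "P r < P x" "Q r < Q x" "P r - Q r < P x - Q x"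
    using pos assms by (auto intro: PQ_strict_mono gap_strict_mono_outer)
  moreover have "1 \<le> P r + Q r" "Q r \<le> 1 + P r" "P s \<le> 1 + Q s" using assms by (auto simp: tri_def)
  ultimately show "1 < P x + Q x" "Q x < 1 + P x" "P x < 1 + Q x" by linarith+
qed

lemma tri_segment_inner:
  assumes "tri r" "tri s" "n * P s \<le> m * Q s" "x \<in> {r..s}"
  shows "tri x"
proof (cases "x = r \<or> x = s")
  case False
  then have x: "r < x" "x < s" using assms(4) by auto
  then have "0 < x" using assms(1) by (simp add: tri_def)
  then show ?thesis
    using tri_between_inner[OF assms(1-3) x] by (simp add: tri_def)
qed (use assms in auto)

lemma tri_segment_outer:
  assumes "tri r" "tri s" "m * Q r \<le> n * P r" "x \<in> {r..s}"
  shows "tri x"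
proof (cases "x = r \<or> x = s")
  case False
  then have x: "r < x" "x < s" using assms(4) by auto
  then have "0 < x" using assms(1) by (simp add: tri_def)
  then show ?thesis
    using tri_between_outer[OF assms(1-3) x] by (simp add: tri_def)
qed (use assms in auto)

lemma H_strict_mono_inner:
  assumes "tri r" "tri s" "n * P s \<le> m * Q s" "r < s"
  shows "H r < H s"
proof (rule DERIV_pos_imp_increasing_open[OF assms(4)])
  fix x assume x: "r < x" "x < s"
  then have x0: "0 < x" using assms by (auto simp: tri_def)
  have "n * P x < m * Q x" using assms x x0 by (intro inner_less[of x s]) auto
  then have pos: "0 < (m * Q x)\<^sup>2 - (n * P x)\<^sup>2"
    using PQ_pos[OF x0] by (simp add: power_strict_mono)
  obtain D where "0 < D" "(H has_real_derivative ((m * Q x)\<^sup>2 - (n * P x)\<^sup>2) * D) (at x)"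
    using H_deriv[OF x0 tri_between_inner[OF assms(1-3) x]] by blast
  then show "\<exists>y. (H has_real_derivative y) (at x) \<and> 0 < y"
    using pos by (meson mult_pos_pos)
qed (rule continuous_H, rule tri_segment_inner[OF assms(1-3)])

lemma H_strict_antimono_outer:
  assumes "tri r" "tri s" "m * Q r \<le> n * P r" "r < s"
  shows "H s < H r"
proof (rule DERIV_neg_imp_decreasing_open[OF assms(4)])
  fix x assume x: "r < x" "x < s"
  then have x0: "0 < x" and r0: "0 < r" using assms by (auto simp: tri_def)
  have "m * Q x < n * P x" using assms x r0 by (intro outer_less[of r x]) auto
  then have neg: "(m * Q x)\<^sup>2 - (n * P x)\<^sup>2 < 0"
    using PQ_pos[OF x0] by (simp add: power_strict_mono)
  obtain D where "0 < D" "(H has_real_derivative ((m * Q x)\<^sup>2 - (n * P x)\<^sup>2) * D) (at x)"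
    using H_deriv[OF x0 tri_between_outer[OF assms(1-3) x]] by blast
  then show "\<exists>y. (H has_real_derivative y) (at x) \<and> y < 0"
    using neg by (meson mult_neg_pos)
qed (rule continuous_H, rule tri_segment_outer[OF assms(1-3)])


section \<open>Roots, phases and the upper bound for coprime exponents\<close>

definition roots :: "complex set" where
  "roots = {z. A * z ^ n + B * cnj z ^ m = 1}"

text \<open>The weights eliminate the argument of \<open>z\<close>: it enters the two terms with
  factors \<open>n * m\<close> and \<open>- n * m\<close>, so modulo \<open>2 * pi\<close> only
  \<open>A\<close> and \<open>B\<close> matter.\<close>

definition phase :: "complex \<Rightarrow> real" where
  "phase z = m * Arg (A * z ^ n) + n * Arg (B * cnj z ^ m)"

definition target :: complex where "target = sgn A ^ m * sgn B ^ n"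

text \<open>A degenerate triangle belongs to the upper class iff \<open>A * z ^ n\<close> is negative.\<close>

definition upper :: "complex \<Rightarrow> bool" where "upper z \<longleftrightarrow> 0 < Arg (A * z ^ n)"

text \<open>The radius is at most the turning radius, which itself counts as inner.\<close>

definition inner :: "complex \<Rightarrow> bool" where
  "inner z \<longleftrightarrow> n * P (cmod z) \<le> m * Q (cmod z)"

abbreviation inner_roots :: "complex set" where
  "inner_roots \<equiv> {z \<in> roots. inner z}"

abbreviation outer_roots :: "bool \<Rightarrow> complex set" where
  "outer_roots b \<equiv> {z \<in> roots. \<not> inner z \<and> (upper z \<longleftrightarrow> b)}"

lemma root_terms:
  assumes "z \<in> roots"
  shows "z \<noteq> 0" "A * z ^ n \<noteq> 0" "B * cnj z ^ m \<noteq> 0" "A * z ^ n + B * cnj z ^ m = 1"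
proof -
  show "z \<noteq> 0"
    using assms m mn by (auto simp: roots_def power_0_left)
  then show "A * z ^ n \<noteq> 0" "B * cnj z ^ m \<noteq> 0" using A B by auto
  show "A * z ^ n + B * cnj z ^ m = 1" using assms by (simp add: roots_def)
qed

lemma cmod_terms: "cmod (A * z ^ n) = P (cmod z)" "cmod (B * cnj z ^ m) = Q (cmod z)"
  by (simp_all add: P_def Q_def norm_mult norm_power)

lemma root_tri:
  assumes "z \<in> roots"
  shows "tri (cmod z)"
proof -
  let ?u = "A * z ^ n" and ?v = "B * cnj z ^ m"
  have "?u + ?v = 1" by (rule root_terms(4)[OF assms])
  moreover from this have "1 - ?u = ?v" "1 - ?v = ?u" by (metis add_diff_cancel_left' add_diff_cancel_right')+
  ultimately have "cmod (?u + ?v) = 1" "cmod (1 - ?u) = cmod ?v" "cmod (1 - ?v) = cmod ?u"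
    by simp_all
  then show ?thesis
    using norm_triangle_ineq[of ?u ?v] norm_triangle_ineq4[of 1 ?u] norm_triangle_ineq4[of 1 ?v]
      root_terms(1)[OF assms]
    unfolding cmod_terms tri_def by simp
qed

lemma cis_phase:
  assumes "z \<in> roots"
  shows "cis (phase z) = target"
proof -
  note nz = root_terms[OF assms]
  have sgn_power: "sgn (x ^ k) = sgn x ^ k" for x :: complex and k
    by (induction k) (simp_all add: sgn_mult)
  have "cis (phase z) = sgn (A * z ^ n) ^ m * sgn (B * cnj z ^ m) ^ n"
    using nz by (simp add: phase_def cis_Arg DeMoivre flip: cis_mult cis_Arg)
  also have "\<dots> = target * (sgn z * sgn (cnj z)) ^ (n * m)"
    by (simp add: target_def sgn_mult sgn_power power_mult_distrib mult_ac flip: power_mult)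
  also have "sgn z * sgn (cnj z) = 1"
    using nz(1) by (simp add: sgn_eq complex_norm_square[symmetric] power2_eq_square)
  finally show ?thesis by simp
qed

lemma root_angles:
  assumes "z \<in> roots"
  shows "\<bar>Arg (A * z ^ n)\<bar> = triangle_angle (P (cmod z)) (Q (cmod z))"
    and "\<bar>Arg (B * cnj z ^ m)\<bar> = triangle_angle (Q (cmod z)) (P (cmod z))"
  using abs_Arg_eq_triangle_angle[of "A * z ^ n" "B * cnj z ^ m"]
    abs_Arg_eq_triangle_angle[of "B * cnj z ^ m" "A * z ^ n"] root_terms[OF assms]
  unfolding cmod_terms by (simp_all add: add.commute)

lemma phase_eq_H:
  assumes "z \<in> roots"
  shows "phase z = (if upper z then H (cmod z) else - H (cmod z))"
  using Arg_summands_of_one[OF root_terms(4)[OF assms] root_terms(2)[OF assms] root_terms(3)[OF assms]]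
  unfolding phase_def H_def upper_def root_angles[OF assms, symmetric]
  by (auto simp: algebra_simps)

text \<open>The lower bounds are strict because \<open>Arg\<close> never equals \<open>- pi\<close>,
  while a negative real term has argument \<open>pi\<close>.\<close>

lemma phase_bounds:
  assumes "z \<in> roots"
  shows "upper z \<Longrightarrow> - real n * pi < phase z \<and> phase z \<le> real m * pi"
    and "\<not> upper z \<Longrightarrow> - real m * pi < phase z \<and> phase z \<le> real n * pi"
proof -
  define a b where "a = Arg (A * z ^ n)" and "b = Arg (B * cnj z ^ m)"
  have bd: "- pi < a" "a \<le> pi" "- pi < b" "b \<le> pi"
    using Arg_bounded unfolding a_def b_def by auto
  note sg = Arg_summands_of_one[OF root_terms(4)[OF assms] root_terms(2)[OF assms] root_terms(3)[OF assms], folded a_def b_def]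
  have ph: "phase z = m * a + n * b" by (simp add: phase_def a_def b_def)
  have "0 < n" using mn by simp
  show "- real n * pi < phase z \<and> phase z \<le> real m * pi" if "upper z"
  proof -
    have "0 < a" "b \<le> 0" using sg that by (auto simp: upper_def a_def)
    then have "0 < m * a" "m * a \<le> m * pi" "n * b \<le> 0"
      using bd m by (auto simp: mult_le_0_iff)
    moreover have "n * (- pi) < n * b"
      using bd \<open>0 < n\<close> by (intro mult_strict_left_mono) auto
    ultimately show ?thesis unfolding ph by auto
  qed
  show "- real m * pi < phase z \<and> phase z \<le> real n * pi" if "\<not> upper z"
  proof -
    have "a \<le> 0" "0 \<le> b" using sg that by (auto simp: upper_def a_def)
    then have "m * a \<le> 0" "0 \<le> n * b" "n * b \<le> n * pi"
      using bd by (auto simp: mult_le_0_iff intro!: mult_left_mono)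
    moreover have "m * (- pi) < m * a"
      using bd m by (intro mult_strict_left_mono) auto
    ultimately show ?thesis unfolding ph by auto
  qed
qed

text \<open>\<open>P + Q\<close> grows from 0 and passes 1; there the triangle is flat with both
  angles 0. This is where the increasing branch of \<open>H\<close> starts.\<close>

lemma inner_start:
  assumes "0 < r" "n * P r \<le> m * Q r" "1 \<le> P r + Q r"
  obtains r1 where "tri r1" "r1 \<le> r" "P r1 + Q r1 = 1" "H r1 = 0"
proof -
  have "\<exists>x. 0 \<le> x \<and> x \<le> r \<and> P x + Q x = 1"
    by (intro IVT'[of "\<lambda>x. P x + Q x" 0 1 r] continuous_on_add continuous_PQ) (use assms in simp_all)
  then obtain x where x: "0 \<le> x" "x \<le> r" "P x + Q x = 1" by blast
  then have "x \<noteq> 0" by auto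
  then have x0: "0 < x" using x by simp
  note pq = PQ_pos[OF x0]
  have "triangle_angle (P x) (Q x) = 0" "triangle_angle (Q x) (P x) = 0"
    using pq x by (intro triangle_angle_eq_0; linarith)+
  then have "H x = 0" by (simp add: H_def)
  moreover have "tri x" using pq x x0 by (auto simp: tri_def)
  ultimately show ?thesis using that x by blast
qed

lemma H_inner_pos:
  assumes "tri r" "n * P r \<le> m * Q r"
  shows "P r + Q r = 1 \<and> H r = 0 \<or> 0 < H r"
proof -
  obtain r1 where r1: "tri r1" "r1 \<le> r" "P r1 + Q r1 = 1" "H r1 = 0"
    using inner_start[of r] assms by (auto simp: tri_def)
  show ?thesis
    using H_strict_mono_inner[OF r1(1) assms] r1 by (cases "r1 = r") auto
qed

text \<open>\<open>H\<close> is nonnegative on this branch, so the sign of the phase separates the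
  two mirror classes. Phase 0 occurs only for \<open>P + Q = 1\<close>, where both terms are
  positive reals and the root is not upper.\<close>

lemma inner_phase_sign:
  assumes "z \<in> roots" "inner z"
  shows "upper z \<longleftrightarrow> 0 < phase z"
proof -
  have H: "P (cmod z) + Q (cmod z) = 1 \<and> H (cmod z) = 0 \<or> 0 < H (cmod z)"
    using H_inner_pos root_tri assms by (simp add: inner_def)
  have "P (cmod z) + Q (cmod z) \<noteq> 1" if up: "upper z"
  proof
    assume eq: "P (cmod z) + Q (cmod z) = 1"
    have "0 < P (cmod z)" "0 < Q (cmod z)" using root_terms(1)[OF assms(1)] by (auto intro: PQ_pos)
    then have "triangle_angle (P (cmod z)) (Q (cmod z)) = 0"
      using eq by (intro triangle_angle_eq_0) linarith+
    then show False
      using root_angles(1)[OF assms(1)] up by (simp add: upper_def)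
  qed
  then show ?thesis using H phase_eq_H[OF assms(1)] by auto
qed

text \<open>The sign of the phase cuts off the range towards plus or minus \<open>n * pi\<close>, so
  both classes share one interval with only \<open>m\<close> admissible phases.\<close>

lemma inner_phase_bounds:
  assumes "z \<in> roots" "inner z"
  shows "- real m * pi < phase z \<and> phase z \<le> real m * pi"
proof (cases "upper z")
  case True
  then have "0 < phase z" using inner_phase_sign[OF assms] by simp
  moreover have "- real m * pi \<le> 0" by simp
  ultimately show ?thesis using phase_bounds(1)[OF assms(1) True] by linarith
next
  case False
  then have "phase z \<le> 0" using inner_phase_sign[OF assms] by simp
  moreover have "0 \<le> real m * pi" by simp
  ultimately show ?thesis using phase_bounds(2)[OF assms(1) False] by linarith
qed

text \<open>Modulus and class determine \<open>A * z ^ n\<close>, hence also the other term, and so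
  both \<open>z ^ n\<close> and \<open>z ^ m\<close>.\<close>

lemma root_unique:
  assumes cop: "coprime n m" and z: "z \<in> roots" and w: "w \<in> roots"
    and mod: "cmod z = cmod w" and up: "upper z \<longleftrightarrow> upper w"
  shows "z = w"
proof -
  have "\<bar>Arg (A * z ^ n)\<bar> = \<bar>Arg (A * w ^ n)\<bar>"
    using root_angles(1)[OF z] root_angles(1)[OF w] mod by simp
  then have "Arg (A * z ^ n) = Arg (A * w ^ n)"
    using up by (auto simp: upper_def abs_if split: if_splits)
  moreover have "cmod (A * z ^ n) = cmod (A * w ^ n)"
    unfolding cmod_terms mod ..
  ultimately have eq: "A * z ^ n = A * w ^ n"
    by (metis rcis_cmod_Arg)
  then have "B * cnj z ^ m = B * cnj w ^ m"
    using root_terms(4)[OF z] root_terms(4)[OF w] by (metis add_left_cancel)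
  then have "cnj (z ^ m) = cnj (w ^ m)" using B by simp
  then have pm: "z ^ m = w ^ m" by (simp only: complex_cnj_cancel_iff)
  have pn: "z ^ n = w ^ n" using eq A by simp
  have w0: "w \<noteq> 0" using root_terms(1)[OF w] .
  \<comment> \<open>The quotient \<open>z / w\<close> is both an \<open>n\<close>-th and an
    \<open>m\<close>-th root of unity; Bezout makes it 1.\<close>
  obtain x y where xy: "n * x = m * y + 1"
    using bezout_nat[of n m] cop mn by auto
  have "(z / w) ^ (n * x) = 1" "(z / w) ^ (m * y) = 1"
    using pn pm w0 by (simp_all add: power_mult power_divide)
  then have "z / w = 1" unfolding xy by simp
  then show ?thesis using w0 by simp
qed

text \<open>The sign of the phase gives the class, then the phase gives \<open>H\<close>, and
  monotonicity of \<open>H\<close> gives the modulus.\<close>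

lemma inj_phase_inner:
  assumes "coprime n m"
  shows "inj_on phase inner_roots"
proof (intro inj_onI, clarify)
  fix z w assume z: "z \<in> roots" "inner z" and w: "w \<in> roots" "inner w" and eq: "phase z = phase w"
  have up: "upper z \<longleftrightarrow> upper w"
    using inner_phase_sign[OF z] inner_phase_sign[OF w] eq by simp
  then have H: "H (cmod z) = H (cmod w)"
    using phase_eq_H[OF z(1)] phase_eq_H[OF w(1)] eq by (auto split: if_splits)
  have "cmod z = cmod w"
    using H_strict_mono_inner[of "cmod z" "cmod w"] H_strict_mono_inner[of "cmod w" "cmod z"]
      root_tri[OF z(1)] root_tri[OF w(1)] z w H
    by (cases "cmod z" "cmod w" rule: linorder_cases) (auto simp: inner_def)
  then show "z = w" using root_unique assms z w up by blast
qed

text \<open>The class is fixed by \<open>b\<close>, because the phase intervals of the two outer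
  classes overlap.\<close>

lemma inj_phase_outer:
  assumes "coprime n m"
  shows "inj_on phase (outer_roots b)"
proof (rule inj_onI)
  fix z w
  assume "z \<in> outer_roots b" "w \<in> outer_roots b"
    and eq: "phase z = phase w"
  then have z: "z \<in> roots" "\<not> inner z" and w: "w \<in> roots" "\<not> inner w"
    and up: "upper z \<longleftrightarrow> b" "upper w \<longleftrightarrow> b" by auto
  then have H: "H (cmod z) = H (cmod w)"
    using phase_eq_H[OF z(1)] phase_eq_H[OF w(1)] eq by (auto split: if_splits)
  have "cmod z = cmod w"
    using H_strict_antimono_outer[of "cmod z" "cmod w"] H_strict_antimono_outer[of "cmod w" "cmod z"]
      root_tri[OF z(1)] root_tri[OF w(1)] z w H
    by (cases "cmod z" "cmod w" rule: linorder_cases) (auto simp: inner_def)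
  then show "z = w" using root_unique assms z w up by blast
qed

lemma phase_image_subset:
  "phase ` inner_roots \<subseteq> phases target (- real m * pi) (real m * pi)"
  "phase ` (outer_roots True) \<subseteq> phases target (- real n * pi) (real m * pi)"
  "phase ` (outer_roots False) \<subseteq> phases target (- real m * pi) (real n * pi)"
  using inner_phase_bounds phase_bounds cis_phase by (auto simp: phases_def)

lemma roots_split:
  "roots = inner_roots \<union> (outer_roots True \<union>
     outer_roots False)"
  by blast

lemma target_cis: "cis (Arg target) = target"
proof -
  have "cmod target = 1" using A B by (simp add: target_def norm_mult norm_power norm_sgn)
  then show ?thesis by (metis cis_Arg norm_zero sgn_div_norm inverse_1 scaleR_one zero_neq_one)
qed

lemma finite_phases_target: "a \<le> b \<Longrightarrow> finite (phases target a b)"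
  using phases_card(1)[of a b "Arg target"] by (simp add: target_cis)

lemma phases_target_card:
  "card (phases target (- real m * pi) (real m * pi)) = m"
  "card (phases target (- real n * pi) (real m * pi)) +
   card (phases target (- real m * pi) (real n * pi)) = n + m"
  using phases_card_symmetric[of "Arg target" m] phases_card_swapped[of "Arg target" n m]
  by (simp_all add: target_cis)

lemma pi_interval: "- real k * pi \<le> real l * pi"
  by (rule mult_right_mono) auto

text \<open>The phase is injective on each of three classes: \<open>m\<close> values are available
  to the inner roots and \<open>n + m\<close> to the two outer classes together.\<close>

theorem roots_card_le:
  assumes "coprime n m"
  shows "finite roots" "card roots \<le> n + 2 * m"
proof -
  note fin = finite_phases_target[OF pi_interval]
  note inj = inj_phase_inner[OF assms] inj_phase_outer[OF assms, of True] inj_phase_outer[OF assms, of False]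
  show "finite roots"
    by (subst roots_split, intro finite_UnI)
      (rule inj_on_finite[OF inj(1) phase_image_subset(1) fin]
        inj_on_finite[OF inj(2) phase_image_subset(2) fin]
        inj_on_finite[OF inj(3) phase_image_subset(3) fin])+
  have "card roots \<le> card inner_roots +
      (card (outer_roots True) + card (outer_roots False))"
    by (subst roots_split) (meson add_left_mono card_Un_le le_trans)
  also have "\<dots> \<le> card (phases target (- real m * pi) (real m * pi)) +
      (card (phases target (- real n * pi) (real m * pi)) + card (phases target (- real m * pi) (real n * pi)))"
    by (intro add_mono card_inj_on_le[OF inj(1) phase_image_subset(1) fin]
        card_inj_on_le[OF inj(2) phase_image_subset(2) fin] card_inj_on_le[OF inj(3) phase_image_subset(3) fin])
  finally show "card roots \<le> n + 2 * m"
    using phases_target_card by simp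
qed

text \<open>Reduces sharpness to showing that every admissible phase is attained in each of the
  three classes.\<close>

lemma roots_card_ge:
  assumes "coprime n m"
    and "phases target (- real m * pi) (real m * pi) \<subseteq> phase ` inner_roots"
    and "phases target (- real n * pi) (real m * pi) \<subseteq> phase ` (outer_roots True)"
    and "phases target (- real m * pi) (real n * pi) \<subseteq> phase ` (outer_roots False)"
  shows "n + 2 * m \<le> card roots"
proof -
  have fin: "finite {z \<in> roots. R z}" for R
    using roots_card_le(1)[OF assms(1)] by simp
  have "n + 2 * m = card (phases target (- real m * pi) (real m * pi)) +
      (card (phases target (- real n * pi) (real m * pi)) + card (phases target (- real m * pi) (real n * pi)))"
    using phases_target_card by simp
  also have "\<dots> \<le> card inner_roots +
      (card (outer_roots True) + card (outer_roots False))"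
    by (intro add_mono surj_card_le[OF fin assms(2)] surj_card_le[OF fin assms(3)] surj_card_le[OF fin assms(4)])
  also have "\<dots> = card (inner_roots \<union> (outer_roots True \<union>
     outer_roots False))"
    by (subst card_Un_disjoint, (use fin in auto)[3], subst card_Un_disjoint) (use fin in auto)
  finally show ?thesis using roots_split by simp
qed


section \<open>Attaining the bound n + 2m for n = m + 1\<close>

text \<open>The triangle at radius \<open>r\<close>, or its mirror image if \<open>s = - 1\<close>,
  prescribes both terms; the phase condition makes them come from a common \<open>z\<close>.\<close>

lemma root_exists:
  assumes n: "n = Suc m" and r: "tri r" and s: "s = 1 \<or> s = - 1"
    and tgt: "cis (s * H r) = target" and nonreal: "Im target \<noteq> 0"
  obtains z where "z \<in> roots" "cmod z = r" "upper z \<longleftrightarrow> s = 1"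
proof -
  define a b where "a = triangle_angle (P r) (Q r)" and "b = triangle_angle (Q r) (P r)"
  define u v where "u = of_real (P r) * cis (s * a)" and "v = of_real (Q r) * cis (- s * b)"
  have r0: "0 < r" using r by (simp add: tri_def)
  note pq = PQ_pos[OF r0]
  have tri: "1 \<le> P r + Q r" "Q r \<le> 1 + P r" "P r \<le> 1 + Q r" using r by (auto simp: tri_def)
  have sum: "of_real (P r) * cis a + of_real (Q r) * cis (- b) = 1"
    unfolding a_def b_def using pq tri by (intro triangle_closes)
  from arg_cong[OF sum, of cnj] have "of_real (P r) * cis (- a) + of_real (Q r) * cis b = 1"
    by (simp add: cis_cnj)
  with sum s have uv: "u + v = 1" by (auto simp: u_def v_def)
  define \<xi> \<eta> where "\<xi> = cis (s * a) / sgn A" and "\<eta> = cis (- s * b) / sgn B"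
  have sg: "cmod (sgn A) = 1" "cmod (sgn B) = 1" using A B by (simp_all add: norm_sgn)
  then have unit: "cmod \<xi> = 1" "cmod \<eta> = 1" by (simp_all add: \<xi>_def \<eta>_def norm_divide)
  \<comment> \<open>The phase condition becomes the relation that \<open>w ^ n\<close> and
    \<open>cnj w ^ m\<close> satisfy for every unit \<open>w\<close>.\<close>
  have "cis (s * H r) = cis (s * a) ^ m * cis (- s * b) ^ n"
    unfolding H_def a_def[symmetric] b_def[symmetric] DeMoivre cis_mult
    by (rule arg_cong[of _ _ cis]) (simp add: algebra_simps)
  then have one: "\<xi> ^ m * \<eta> ^ n = 1"
    using tgt sg A B unfolding target_def \<xi>_def \<eta>_def
    by (auto simp: power_divide sgn_zero_iff)
  \<comment> \<open>As \<open>n = m + 1\<close>, the direction \<open>w\<close> of the root solving \<open>w ^ n = \<xi>\<close> and \<open>cnj w ^ m = \<eta>\<close> is \<open>w ^ n * cnj w ^ m\<close>.\<close>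
  define z where "z = of_real r * (\<xi> * \<eta>)"
  have zr: "cmod z = r" using unit r0 by (simp add: z_def norm_mult)
  have "(\<xi> * \<eta>) ^ n = \<xi> * (\<xi> ^ m * \<eta> ^ n)"
    by (simp add: n power_mult_distrib mult_ac)
  then have zn: "(\<xi> * \<eta>) ^ n = \<xi>" using one by simp
  have "(\<xi> * \<eta>) ^ m * \<eta> = 1"
    using one by (simp add: n power_mult_distrib mult_ac)
  moreover have "cnj (\<xi> * \<eta>) ^ m * (\<xi> * \<eta>) ^ m = 1"
    using unit by (simp add: complex_norm_square[symmetric] norm_mult mult.commute[of "cnj _"] flip: power_mult_distrib complex_cnj_mult)
  ultimately have zm: "cnj (\<xi> * \<eta>) ^ m = \<eta>"
    by (metis mult.assoc mult.commute mult_1)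
  have "A * z ^ n = of_real (cmod A) * sgn A * (of_real r ^ n * \<xi>)"
    using zn A by (simp add: z_def power_mult_distrib[of "of_real r"] sgn_eq)
  also have "\<dots> = u"
    using A by (simp add: \<xi>_def u_def P_def sgn_zero_iff)
  finally have zu: "A * z ^ n = u" .
  have "B * cnj z ^ m = of_real (cmod B) * sgn B * (of_real r ^ m * \<eta>)"
    using zm B by (simp add: z_def power_mult_distrib[of "of_real r"] sgn_eq)
  also have "\<dots> = v"
    using B by (simp add: \<eta>_def v_def Q_def sgn_zero_iff)
  finally have zv: "B * cnj z ^ m = v" .
  have z: "z \<in> roots" using uv by (simp add: roots_def zu zv)
  \<comment> \<open>A flat triangle has both terms real, which would make \<open>target\<close>
    real. So \<open>a\<close> is neither 0 nor \<open>pi\<close>, and \<open>s\<close> decides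
    \<open>upper\<close>.\<close>
  have "sin a \<noteq> 0"
  proof
    assume "sin a = 0"
    then have "Im u = 0" using s by (auto simp: u_def)
    moreover from this have "Im v = 0" using uv by (auto simp: complex_eq_iff)
    ultimately have "u \<in> \<real>" "v \<in> \<real>" by (simp_all add: complex_is_Real_iff)
    then have "sgn u \<in> \<real>" "sgn v \<in> \<real>" by (auto simp: sgn_eq)
    then have "sgn u ^ m * sgn v ^ n \<in> \<real>" by auto
    moreover have "sgn u ^ m * sgn v ^ n = target"
      using cis_phase[OF z] root_terms[OF z] unfolding phase_def zu zv
      by (simp add: cis_Arg DeMoivre flip: cis_mult cis_Arg)
    ultimately show False using nonreal by (simp add: complex_is_Real_iff)
  qed
  moreover have "0 \<le> a" "a \<le> pi"
    unfolding a_def using pq tri by (auto intro!: triangle_angle_bounds)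
  ultimately have a: "0 < a" "a < pi" by (auto simp: less_le)
  have "Arg u = s * a"
    unfolding u_def using s a pq by (intro Arg_rcis) auto
  then have "upper z \<longleftrightarrow> s = 1" using s a by (auto simp: upper_def zu)
  then show ?thesis using that z zr by blast
qed

lemma H_at_Q_eq:
  assumes "0 < r" "Q r = 1 + P r"
  shows "tri r" "H r = m * pi"
proof -
  note pq = PQ_pos[OF assms(1)]
  show "tri r" using assms pq by (simp add: tri_def)
  have "triangle_angle (P r) (Q r) = pi" "triangle_angle (Q r) (P r) = 0"
    using triangle_angle_eq_pi[OF pq(1)] triangle_angle_eq_0[OF pq(2), of "P r"] assms(2) pq by simp_all
  then show "H r = m * pi" by (simp add: H_def)
qed

lemma H_at_P_eq:
  assumes "0 < r" "P r = 1 + Q r"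
  shows "tri r" "H r = - real n * pi"
proof -
  note pq = PQ_pos[OF assms(1)]
  show "tri r" using assms pq by (simp add: tri_def)
  have "triangle_angle (Q r) (P r) = pi" "triangle_angle (P r) (Q r) = 0"
    using triangle_angle_eq_pi[OF pq(2)] triangle_angle_eq_0[OF pq(1), of "Q r"] assms(2) pq by simp_all
  then show "H r = - real n * pi" by (simp add: H_def)
qed

text \<open>\<open>H\<close> runs from 0, where \<open>P + Q = 1\<close>, to \<open>m * pi\<close>,
  where \<open>Q - P = 1\<close>; the gap at \<open>r0\<close> ensures that the latter radius is at
  most \<open>r0\<close>.\<close>

lemma H_onto_inner:
  assumes r0: "0 < r0" "n * P r0 \<le> m * Q r0" "1 + P r0 \<le> Q r0" and h: "0 \<le> h" "h \<le> m * pi"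
  obtains r where "tri r" "n * P r \<le> m * Q r" "H r = h"
proof -
  have "\<exists>x. 0 \<le> x \<and> x \<le> r0 \<and> Q x - P x = 1"
    by (intro IVT'[of "\<lambda>x. Q x - P x" 0 1 r0] continuous_on_diff continuous_PQ) (use r0 in simp_all)
  then obtain r2 where r2: "0 \<le> r2" "r2 \<le> r0" "Q r2 - P r2 = 1" by blast
  then have "r2 \<noteq> 0" by auto
  then have pos2: "0 < r2" using r2 by simp
  have q2: "Q r2 = 1 + P r2" using r2 by simp
  note H2 = H_at_Q_eq[OF pos2 q2]
  have in2: "n * P r2 \<le> m * Q r2"
  proof (cases "r2 = r0")
    case False
    then show ?thesis using inner_less[OF pos2 _ r0(2)] r2(2) by simp
  qed (use r0 in simp)
  have "1 \<le> P r2 + Q r2" using H2(1) by (simp add: tri_def)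
  then obtain r1 where r1: "tri r1" "r1 \<le> r2" "H r1 = 0"
    using inner_start[OF pos2 in2] by blast
  note seg = tri_segment_inner[OF r1(1) H2(1) in2]
  have "\<exists>x. r1 \<le> x \<and> x \<le> r2 \<and> H x = h"
    using IVT'[of H r1 h r2, OF _ _ r1(2) continuous_H[OF seg]] r1(3) H2(2) h by simp
  then obtain r where r: "r1 \<le> r" "r \<le> r2" "H r = h" by blast
  then have "tri r" by (intro seg) auto
  moreover from this have "n * P r \<le> m * Q r"
  proof (cases "r = r2")
    case False
    then show ?thesis
      using inner_less[OF _ _ in2, of r] r(2) \<open>tri r\<close> by (simp add: tri_def)
  qed (use in2 in simp)
  ultimately show ?thesis using that r by blast
qed

text \<open>Beyond \<open>r0\<close>, \<open>Q - P\<close> falls to 1, where \<open>H\<close> is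
  \<open>m * pi\<close>, and later to -1, where \<open>H\<close> is \<open>- n * pi\<close>; all
  values in between are taken.\<close>

lemma H_onto_outer:
  assumes r0: "0 < r0" "m * Q r0 \<le> n * P r0" "1 + P r0 < Q r0"
    and R: "r0 \<le> R" "1 + Q R \<le> P R" and h: "- real n * pi \<le> h" "h \<le> m * pi"
  obtains r where "tri r" "m * Q r < n * P r" "H r = h"
proof -
  have "\<exists>x. r0 \<le> x \<and> x \<le> R \<and> P x - Q x = 1"
    by (intro IVT'[of "\<lambda>x. P x - Q x" r0 1 R] continuous_on_diff continuous_PQ) (use r0 R in simp_all)
  then obtain r3 where r3: "r0 \<le> r3" "r3 \<le> R" "P r3 - Q r3 = 1" by blast
  have "\<exists>x. r0 \<le> x \<and> x \<le> r3 \<and> P x - Q x = - 1"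
    by (intro IVT'[of "\<lambda>x. P x - Q x" r0 "- 1" r3] continuous_on_diff continuous_PQ) (use r0 r3 in simp_all)
  then obtain r2 where r2: "r0 \<le> r2" "r2 \<le> r3" "P r2 - Q r2 = - 1" by blast
  have pos: "0 < r2" "0 < r3" using r0 r2 r3 by auto
  \<comment> \<open>The strict gap at \<open>r0\<close> puts the first flat triangle strictly beyond
    \<open>r0\<close>, hence on the outer side.\<close>
  have "r0 \<noteq> r2" using r0 r2 by auto
  then have out: "m * Q r2 < n * P r2" using outer_less[OF r0(1) _ r0(2), of r2] r2(1) by simp
  have eqs: "Q r2 = 1 + P r2" "P r3 = 1 + Q r3" using r2 r3 by auto
  note H2 = H_at_Q_eq[OF pos(1) eqs(1)] and H3 = H_at_P_eq[OF pos(2) eqs(2)]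
  note seg = tri_segment_outer[OF H2(1) H3(1) less_imp_le[OF out]]
  have "\<exists>x. r2 \<le> x \<and> x \<le> r3 \<and> H x = h"
    using IVT2'[of H r3 h r2, OF _ _ r2(2) continuous_H[OF seg]] H2(2) H3(2) h by simp
  then obtain r where r: "r2 \<le> r" "r \<le> r3" "H r = h" by blast
  then have "tri r" by (intro seg) auto
  moreover have "m * Q r < n * P r"
  proof (cases "r = r2")
    case False
    then show ?thesis using outer_less[OF pos(1) _ less_imp_le[OF out], of r] r(1) by simp
  qed (use out in simp)
  ultimately show ?thesis using that r by blast
qed

theorem roots_card_eq:
  assumes n: "n = Suc m" and nonreal: "Im target \<noteq> 0"
    and r0: "0 < r0" "n * P r0 = m * Q r0" "1 + P r0 < Q r0"
    and R: "r0 \<le> R" "1 + Q R \<le> P R"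
  shows "card roots = n + 2 * m"
proof -
  have cop: "coprime n m" unfolding n by simp
  have "n + 2 * m \<le> card roots"
  proof (rule roots_card_ge[OF cop]; rule subsetI)
    fix h assume "h \<in> phases target (- real m * pi) (real m * pi)"
    then have h: "cis h = target" "\<bar>h\<bar> \<le> m * pi" by (auto simp: phases_def)
    obtain r where r: "tri r" "n * P r \<le> m * Q r" "H r = \<bar>h\<bar>"
      using H_onto_inner[of r0 "\<bar>h\<bar>"] r0 h by auto
    \<comment> \<open>Negative inner phases come from the mirror image of the triangle with
      \<open>H r = \<bar>h\<bar>\<close>.\<close>
    define s :: real where "s = (if 0 \<le> h then 1 else - 1)"
    have s: "s = 1 \<or> s = - 1" "s * H r = h" by (auto simp: s_def r)
    obtain z where z: "z \<in> roots" "cmod z = r" "upper z \<longleftrightarrow> s = 1"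
      using root_exists[OF n r(1) s(1)] s h nonreal by auto
    have "phase z = h" using phase_eq_H[OF z(1)] s z by auto
    then show "h \<in> phase ` inner_roots" using z r by (auto simp: inner_def)
  next
    fix h assume "h \<in> phases target (- real n * pi) (real m * pi)"
    then have h: "cis h = target" "- real n * pi \<le> h" "h \<le> m * pi" by (auto simp: phases_def)
    obtain r where r: "tri r" "m * Q r < n * P r" "H r = h"
      using H_onto_outer[OF _ _ _ R h(2,3)] r0 by auto
    obtain z where z: "z \<in> roots" "cmod z = r" "upper z"
      using root_exists[OF n r(1), of 1] r h nonreal by auto
    have "phase z = h" using phase_eq_H[OF z(1)] r z by auto
    then show "h \<in> phase ` (outer_roots True)" using z r by (auto simp: inner_def)
  next
    fix h assume "h \<in> phases target (- real m * pi) (real n * pi)"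
    then have h: "cis h = target" "- real n * pi \<le> - h" "- h \<le> m * pi" by (auto simp: phases_def)
    obtain r where r: "tri r" "m * Q r < n * P r" "H r = - h"
      using H_onto_outer[OF _ _ _ R h(2,3)] r0 by auto
    obtain z where z: "z \<in> roots" "cmod z = r" "\<not> upper z"
      using root_exists[OF n r(1), of "- 1"] r h nonreal by auto
    have "phase z = h" using phase_eq_H[OF z(1)] r z by auto
    then show "h \<in> phase ` (outer_roots False)" using z r by (auto simp: inner_def)
  qed
  then show ?thesis using roots_card_le(2)[OF cop] by simp
qed

end

section \<open>Arbitrary exponents and the extremal family\<close>

lemma harmonic_trinomial_roots_coprime:
  assumes "a \<noteq> 0" "b \<noteq> 0" "c \<noteq> 0" "0 < m" "m < n" "coprime n m"
  shows "finite {z. a * z ^ n + b * cnj z ^ m + c = 0}"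
    and "card {z. a * z ^ n + b * cnj z ^ m + c = 0} \<le> n + 2 * m"
proof -
  \<comment> \<open>Moving \<open>c\<close> to the right and dividing by \<open>- c\<close> makes
    the right-hand side 1.\<close>
  interpret harmonic_pair "- a / c" "- b / c" n m
    using assms by unfold_locales auto
  have "a * z ^ n + b * cnj z ^ m + c = 0 \<longleftrightarrow> (- a / c) * z ^ n + (- b / c) * cnj z ^ m = 1" for z
    using assms(3) by (simp add: field_simps) (auto simp: eq_neg_iff_add_eq_0 add_ac neg_eq_iff_add_eq_0)
  then have "{z. a * z ^ n + b * cnj z ^ m + c = 0} = roots"
    unfolding roots_def by blast
  then show "finite {z. a * z ^ n + b * cnj z ^ m + c = 0}"
    and "card {z. a * z ^ n + b * cnj z ^ m + c = 0} \<le> n + 2 * m"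
    using roots_card_le[OF assms(6)] by simp_all
qed

text \<open>With \<open>d = gcd n m\<close> the trinomial is a coprime one in
  \<open>w = z ^ d\<close>. Each of its at most \<open>n' + 2 * m'\<close> roots has
  \<open>d\<close> preimages, and \<open>d\<close> times this bound is
  \<open>n + 2 * m\<close>.\<close>

theorem harmonic_trinomial_roots:
  assumes "harmonic_trinomial n m f"
  shows "finite (root_set f)" "card (root_set f) \<le> n + 2 * m"
proof -
  obtain a b c where abc: "a \<noteq> 0" "b \<noteq> 0" "c \<noteq> 0" and f: "f = (\<lambda>z. a * z ^ n + b * cnj z ^ m + c)"
    and m: "0 < m" and mn: "m < n"
    using assms by (auto simp: harmonic_trinomial_def)
  define d where "d = gcd n m"
  have d: "0 < d" using m by (simp add: d_def)
  obtain n' m' where nm: "n = n' * d" "m = m' * d" "coprime n' m'"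
    using gcd_coprime_exists[of n m] m unfolding d_def by auto
  define R where "R = {w. a * w ^ n' + b * cnj w ^ m' + c = 0}"
  have "0 < m'" "m' < n'" using m mn d nm by auto
  then have R: "finite R" "card R \<le> n' + 2 * m'"
    unfolding R_def using harmonic_trinomial_roots_coprime[OF abc] nm(3) by auto
  have split: "root_set f = (\<Union>w\<in>R. {z. z ^ d = w})"
    unfolding root_set_def f R_def nm
    by (auto simp: mult.commute[of _ d] power_mult simp flip: complex_cnj_power)
  have nth: "finite {z. z ^ d = w} \<and> card {z. z ^ d = w} = d" if "w \<in> R" for w
  proof -
    \<comment> \<open>At 0 only the non-zero constant \<open>c\<close> is left, so \<open>w\<close>
      has exactly \<open>d\<close> roots of order \<open>d\<close>.\<close>
    have "w \<noteq> 0" using that abc \<open>0 < m'\<close> \<open>m' < n'\<close> by (auto simp: R_def power_0_left)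
    then show ?thesis using card_nth_roots[of w d] d card_ge_0_finite[of "{z. z ^ d = w}"] by auto
  qed
  then show "finite (root_set f)" unfolding split using R by auto
  have "card (root_set f) \<le> (\<Sum>w\<in>R. card {z. z ^ d = w})"
    unfolding split using R by (intro card_UN_le)
  also have "\<dots> = card R * d" using nth by simp
  also have "\<dots> \<le> (n' + 2 * m') * d" using R by (intro mult_right_mono) auto
  finally show "card (root_set f) \<le> n + 2 * m" by (simp add: nm algebra_simps)
qed

text \<open>The coefficients put the turning radius at 1, where \<open>P = 2 * m\<close> and \<open>Q = 2 * m + 2\<close>, and make
  \<open>target = \<i>\<close>, which excludes degenerate triangles.\<close>

lemma extremal_trinomial:
  assumes "0 < m"
  shows "card {z. of_nat (2 * m) * z ^ Suc m +
    of_nat (2 * Suc m) * cis (pi / (2 * real (Suc m))) * cnj z ^ m = 1} = 3 * m + 1"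
proof -
  define A B where "A = (of_nat (2 * m) :: complex)"
    and "B = of_nat (2 * Suc m) * cis (pi / (2 * real (Suc m)))"
  interpret harmonic_pair A B "Suc m" m
    using assms by unfold_locales (auto simp: A_def B_def simp del: of_nat_mult of_nat_Suc)
  have mod: "cmod A = 2 * m" "cmod B = 2 * Suc m"
    unfolding A_def B_def by (simp_all only: norm_mult norm_cis norm_of_nat mult_1_right)
  have "sgn A = 1"
    unfolding sgn_eq mod using assms by (simp add: A_def)
  moreover have "sgn B = cis (pi / (2 * real (Suc m)))"
    unfolding sgn_eq mod by (simp add: B_def del: of_nat_Suc)
  ultimately have "target = cis (real (Suc m) * (pi / (2 * real (Suc m))))"
    by (simp add: target_def DeMoivre del: of_nat_Suc power_Suc)
  also have "real (Suc m) * (pi / (2 * real (Suc m))) = pi / 2"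
    by (simp del: of_nat_Suc)
  finally have nonreal: "Im target \<noteq> 0" by simp
  \<comment> \<open>Chosen to make \<open>m * R - Suc m\<close> equal to 1, so that
    \<open>P R - Q R\<close> becomes \<open>2 * R ^ m\<close>, which is at least 2.\<close>
  define R where "R = real (m + 2) / m"
  have R: "1 \<le> R" "m * R = m + 2" using assms by (auto simp: R_def)
  have "1 \<le> R ^ m" using R by simp
  have "P R - Q R = 2 * R ^ m * (m * R - Suc m)"
    by (simp add: P_def Q_def mod algebra_simps)
  also have "\<dots> = 2 * R ^ m" unfolding R by simp
  finally have "1 + Q R \<le> P R" using \<open>1 \<le> R ^ m\<close> by simp
  then have "card roots = Suc m + 2 * m"
    using R nonreal by (intro roots_card_eq[of 1 R]) (auto simp: P_def Q_def mod)
  also have "\<dots> = 3 * m + 1" by simp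
  finally show ?thesis unfolding roots_def unfolding A_def B_def .
qed

text \<open>Finiteness accompanies each upper bound because \<open>card\<close> of an infinite set
  is 0. Injectivity of \<open>g\<close> rules out a constant family.\<close>

theorem corollary1p6:
  fixes n :: nat
  assumes "n \<ge> 2"
  shows "(\<forall>m\<in>{1..n - 1}. \<forall>f. harmonic_trinomial n m f \<longrightarrow>
             finite (root_set f) \<and> card (root_set f) \<le> 3 * n - 2)
       \<and> (\<exists>m\<in>{1..n - 1}. \<exists>g :: real \<Rightarrow> complex \<Rightarrow> complex.
             inj_on g {0<..} \<and>
             (\<forall>r>0. harmonic_trinomial n m (g r) \<and> card (root_set (g r)) = 3 * n - 2))
       \<and> (\<forall>f. harmonic_trinomial n 1 f \<longrightarrow>
             finite (root_set f) \<and> card (root_set f) \<le> n + 2)"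
proof (intro conjI ballI allI impI)
  \<comment> \<open>Since \<open>m \<le> n - 1\<close>, the bound \<open>n + 2 * m\<close> is at
    most \<open>3 * n - 2\<close>.\<close>
  fix m f assume "m \<in> {1..n - 1}" "harmonic_trinomial n m f"
  then show "finite (root_set f)" "card (root_set f) \<le> 3 * n - 2"
    using harmonic_trinomial_roots[of n m f] by auto
next
  fix f assume "harmonic_trinomial n 1 f"
  then show "finite (root_set f)" "card (root_set f) \<le> n + 2"
    using harmonic_trinomial_roots[of n 1 f] by auto
next
  define m where "m = n - 1"
  have m: "0 < m" "n = Suc m" using assms by (auto simp: m_def)
  define A B where "A = (of_nat (2 * m) :: complex)"
    and "B = of_nat (2 * Suc m) * cis (pi / (2 * real (Suc m)))"
  have AB: "A \<noteq> 0" "B \<noteq> 0"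
    using m by (auto simp: A_def B_def simp del: of_nat_mult of_nat_Suc)
  \<comment> \<open>Scaling the extremal equation by \<open>r\<close> keeps its roots, and the value
    \<open>- r\<close> at 0 tells the members apart.\<close>
  define g :: "real \<Rightarrow> complex \<Rightarrow> complex" where
    "g r = (\<lambda>z. (r * A) * z ^ n + (r * B) * cnj z ^ m + (- r))" for r
  have "inj_on g {0<..}"
  proof (rule inj_onI)
    fix r s assume "g r = g s"
    then have "g r 0 = g s 0" by simp
    then show "r = s" using m by (simp add: g_def power_0_left)
  qed
  moreover have "harmonic_trinomial n m (g r) \<and> card (root_set (g r)) = 3 * n - 2" if "0 < r" for r
  proof
    have "of_real r * A \<noteq> 0" "of_real r * B \<noteq> 0" "- of_real r \<noteq> (0 :: complex)"
      using AB that by auto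
    then show "harmonic_trinomial n m (g r)"
      unfolding harmonic_trinomial_def g_def using m by blast
    have "g r z = of_real r * (A * z ^ n + B * cnj z ^ m - 1)" for z
      by (simp add: g_def algebra_simps)
    then have "root_set (g r) = {z. A * z ^ Suc m + B * cnj z ^ m = 1}"
      using that m(2) by (auto simp: root_set_def)
    then show "card (root_set (g r)) = 3 * n - 2"
      using extremal_trinomial[OF m(1)] m(2) by (simp add: A_def B_def)
  qed
  ultimately show "\<exists>m\<in>{1..n - 1}. \<exists>g :: real \<Rightarrow> complex \<Rightarrow> complex.
      inj_on g {0<..} \<and>
      (\<forall>r>0. harmonic_trinomial n m (g r) \<and> card (root_set (g r)) = 3 * n - 2)"
    using m by (intro bexI[of _ m] exI[of _ g]) auto
qed

end
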